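(* Assume: (i) for some $K>0$ there is a sequence of Borel maps $T_n:\Omega\to V_n$ with $T_n\#\mu=\mu_n$ and $\sup_{x\in\Omega}|T_n(x)-x|\le K\varepsilon_n$ for every $n\in\mathbb N$; (ii) $\eta$ is continuous at $0$, non-increasing, and $\eta(0)>0$; (iii) there is $D>0$ with $\frac1D\le\rho(x)\le D$ for all $x\in\Omega$. Let $n\in\mathbb N$, $s\ge2K\varepsilon_n$ and $x\in V_n$ be such that $B_s(x)\subset\Omega$. Then $$1+|N_{\mathbb G_{n,s}}(x)|\ge\frac{\pi^{d/2}s^d}{\Lambda_n^+\,D\,2^d\,\Gamma\left(\frac d2+1\right)}.$$
   Context: $\mathbb N=\{1,2,\dots\}$; $d\in\mathbb N$; $\Omega\subset\mathbb R^d$ is open and bounded with Lipschitz boundary. $\mu$ is a probability measure on $\Omega$ with continuous density $\rho:\Omega\to\mathbb R$ with respect to Lebesgue measure. For $n\in\mathbb N$, $V_n\subset\Omega$ is a finite set, $\mu_n$ is a probability measure on $V_n$ (also regarded as a measure on $\Omega$), and $\Lambda_n^+:=\max_{x\in V_n}\mu_n(\{x\})$. $(\varepsilon_n)_{n\in\mathbb N}$ is a sequence of positive reals with $\varepsilon_n\to0$; $\eta:[0,\infty)\to[0,\infty)$ is a function (the kernel). The push-forward is $T\#\mu(A):=\mu(T^{-1}(A))$. $B_r(x)$ is the open ball of radius $r$ centred at $x$; $\Gamma$ is Euler's gamma function. For $s>0$, $\mathbb G_{n,s}:=(V_n,E_{n,s})$ is the simple graph where distinct $x,y\in V_n$ are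 adjacent iff $|x-y|\le s$. $N_{\mathbb G}(x)$ is the set of vertices adjacent to $x$ in $\mathbb G$ (not including $x$). *)

theory Defs
  imports "HOL-Analysis.Analysis" "HOL-Probability.Probability_Measure" "Graph_Theory.Pair_Digraph"
begin

text \<open>
  Near each boundary point the set is the strict epigraph of a Lipschitz function in suitably
  rotated Cartesian coordinates. The vector \<open>u\<close> is the last coordinate direction; the other
  coordinates of \<open>x\<close> are recorded by the orthogonal projection \<open>x - (x \<bullet> u) *\<^sub>R u\<close> onto the
  hyperplane orthogonal to \<open>u\<close>, which plays the role of the \<open>d-1\<close> dimensional space on which the
  Lipschitz function lives (a single point if \<open>d = 1\<close>).
\<close>

definition lipschitz_boundary :: "'a::euclidean_space set \<Rightarrow> bool" where
  "lipschitz_boundary S \<longleftrightarrow>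
    (\<forall>p \<in> frontier S. \<exists>r u (g :: 'a \<Rightarrow> real) L.
       r > 0 \<and> norm u = 1 \<and> L-lipschitz_on {y. y \<bullet> u = 0} g \<and>
       S \<inter> ball p r = {x \<in> ball p r. x \<bullet> u > g (x - (x \<bullet> u) *\<^sub>R u)})"

text \<open>An undirected graph is represented as a symmetric digraph, as in the Graph Theory entry.\<close>

definition geometric_graph :: "'a::metric_space set \<Rightarrow> real \<Rightarrow> 'a pair_pre_digraph" where
  "geometric_graph V s =
    \<lparr> pverts = V, parcs = {(x, y). x \<in> V \<and> y \<in> V \<and> x \<noteq> y \<and> dist x y \<le> s} \<rparr>"

lemma pair_graph_geometric_graph:
  assumes "finite V"
  shows "pair_graph (geometric_graph V s)"
proof
  show "finite (pverts (geometric_graph V s))"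
    using assms by (simp add: geometric_graph_def)
  show "finite (parcs (geometric_graph V s))"
    by (rule finite_subset[of _ "V \<times> V"]) (use assms in \<open>auto simp: geometric_graph_def\<close>)
  show "symmetric (with_proj (geometric_graph V s))"
    by (auto simp: geometric_graph_def symmetric_def arcs_ends_def arc_to_ends_def sym_def dist_commute)
qed (auto simp: geometric_graph_def)

definition neighbours :: "'a pair_pre_digraph \<Rightarrow> 'a \<Rightarrow> 'a set" where
  "neighbours G x = {y \<in> pverts G. x \<rightarrow>\<^bsub>G\<^esub> y}"

definition max_mass :: "'a set \<Rightarrow> 'a measure \<Rightarrow> real" where
  "max_mass V M = Max ((\<lambda>x. measure M {x}) ` V)"

end

theory Submission
  imports Defs
begin

text \<open>
  The closed neighbourhood of \<open>x\<close> in the graph, \<open>x\<close> included, is the set \<open>A\<close> of vertices at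
  distance at most \<open>s\<close> from \<open>x\<close>, and its mass can be estimated from both sides. If \<open>\<Lambda>\<close> is the
  largest mass of a vertex, the mass of \<open>A\<close> is at most \<open>card A * \<Lambda>\<close>. On the other hand, the
  transport map moves points by at most \<open>K * \<epsilon> n \<le> s / 2\<close>, so it sends the ball of radius \<open>s / 2\<close> about \<open>x\<close> into \<open>A\<close>; as it
  preserves mass, \<open>A\<close> carries at least the \<open>\<mu>\<close>-mass of that ball, which is at least \<open>1 / D\<close> times its
  volume \<open>\<pi>\<^bsup>d/2\<^esup> (s/2)\<^bsup>d\<^esup> / \<Gamma>(d/2 + 1)\<close>. Comparing the two estimates bounds \<open>card A\<close> from below.
\<close>

lemma card_closed_neighbourhood_geometric_graph:
  assumes "finite V" "x \<in> V" "0 \<le> s"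
  shows "1 + card (neighbours (geometric_graph V s) x) = card (V \<inter> cball x s)"
proof -
  have nb: "neighbours (geometric_graph V s) x = {y \<in> V. x \<noteq> y \<and> dist x y \<le> s}"
    using assms(2) by (auto simp: neighbours_def geometric_graph_def)
  have "V \<inter> cball x s = insert x {y \<in> V. x \<noteq> y \<and> dist x y \<le> s}"
    using assms(2,3) by auto
  then show ?thesis
    using assms(1) by (simp add: nb)
qed

lemma measure_le_card_mult_max_mass:
  assumes "finite_measure M" "finite V" "A \<subseteq> V" "\<And>v. v \<in> V \<Longrightarrow> {v} \<in> sets M"
  shows "measure M A \<le> real (card A) * max_mass V M"
proof -
  have "measure M A = (\<Sum>v\<in>A. measure M {v})"
    using assms by (intro finite_measure.finite_measure_eq_sum_singleton) (auto intro: finite_subset)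
  also have "\<dots> \<le> real (card A) * max_mass V M"
  proof (rule sum_bounded_above)
    fix v assume "v \<in> A"
    then show "measure M {v} \<le> max_mass V M"
      unfolding max_mass_def using assms(2,3) by (intro Max_ge) auto
  qed
  finally show ?thesis .
qed

lemma emeasure_density_restrict_space_ge:
  fixes f :: "'a::euclidean_space \<Rightarrow> ennreal"
  assumes \<Omega>: "\<Omega> \<in> sets borel" and f: "f \<in> borel_measurable (restrict_space borel \<Omega>)"
    and B: "B \<in> sets borel" "B \<subseteq> \<Omega>" and c: "\<And>y. y \<in> B \<Longrightarrow> c \<le> f y"
  shows "c * emeasure lborel B \<le> emeasure (density (restrict_space lborel \<Omega>) f) B"
proof -
  let ?R = "restrict_space lborel \<Omega>"
  have f': "f \<in> borel_measurable ?R"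
    using f by (subst measurable_cong_sets[OF _ refl, of _ "restrict_space borel \<Omega>"])
      (simp_all add: sets_restrict_space)
  have BR: "B \<in> sets ?R"
    using B \<Omega> by (simp add: sets_restrict_space_iff)
  have "c * emeasure lborel B = c * emeasure ?R B"
    using B \<Omega> by (simp add: emeasure_restrict_space)
  also have "\<dots> = (\<integral>\<^sup>+ y. c * indicator B y \<partial>?R)"
    using BR by (simp add: nn_integral_cmult_indicator)
  also have "\<dots> \<le> (\<integral>\<^sup>+ y. f y * indicator B y \<partial>?R)"
    using c by (intro nn_integral_mono) (auto simp: indicator_def)
  also have "\<dots> = emeasure (density ?R f) B"
    using f' BR by (simp add: emeasure_density)
  finally show ?thesis .
qed

text \<open>
  A real supremum bounds its members only if the family is bounded above; for the displacement of a
  map between bounded sets this is automatic.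
\<close>

lemma displacement_le_of_SUP_le:
  fixes T :: "'a::real_normed_vector \<Rightarrow> 'a"
  assumes "bounded \<Omega>" "bounded (T ` \<Omega>)" "(SUP y\<in>\<Omega>. norm (T y - y)) \<le> c" "y \<in> \<Omega>"
  shows "norm (T y - y) \<le> c"
proof -
  obtain a b where a: "\<And>z. z \<in> \<Omega> \<Longrightarrow> norm z \<le> a" and b: "\<And>z. z \<in> \<Omega> \<Longrightarrow> norm (T z) \<le> b"
    using assms(1,2) unfolding bounded_iff by blast
  have "norm (T z - z) \<le> b + a" if "z \<in> \<Omega>" for z
    using norm_triangle_ineq4[of "T z" z] a[OF that] b[OF that] by linarith
  then have "bdd_above ((\<lambda>y. norm (T y - y)) ` \<Omega>)"
    by (auto intro!: bdd_aboveI2)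
  then have "norm (T y - y) \<le> (SUP y\<in>\<Omega>. norm (T y - y))"
    using assms(4) by (rule cSUP_upper2) simp
  then show ?thesis
    using assms(3) by linarith
qed

theorem lemma4p14:
  fixes \<Omega> :: "(real ^ 'd) set"
    and \<mu> :: "(real ^ 'd) measure"
    and \<rho> :: "real ^ 'd \<Rightarrow> real"
    and V :: "nat \<Rightarrow> (real ^ 'd) set"
    and \<mu>s :: "nat \<Rightarrow> (real ^ 'd) measure"
    and \<epsilon> :: "nat \<Rightarrow> real"
    and \<eta> :: "real \<Rightarrow> real"
    and K D s :: real
    and T :: "nat \<Rightarrow> real ^ 'd \<Rightarrow> real ^ 'd"
    and n :: nat
    and x :: "real ^ 'd"
  assumes "open \<Omega>" and "bounded \<Omega>" and "lipschitz_boundary \<Omega>"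
    and "prob_space \<mu>"
    and "continuous_on \<Omega> \<rho>" and "\<forall>y\<in>\<Omega>. 0 \<le> \<rho> y"
    and "\<mu> = density (restrict_space lborel \<Omega>) (\<lambda>y. ennreal (\<rho> y))"
    and "\<forall>m\<ge>1. finite (V m) \<and> V m \<subseteq> \<Omega>"
    and "\<forall>m\<ge>1. prob_space (\<mu>s m) \<and> space (\<mu>s m) = V m \<and>
               sets (\<mu>s m) = sets (restrict_space borel (V m))"
    and "\<forall>m\<ge>1. \<epsilon> m > 0" and "\<epsilon> \<longlonglongrightarrow> 0"
    and "\<forall>t\<ge>0. 0 \<le> \<eta> t"
    and "K > 0"
    and "\<forall>m\<ge>1. T m \<in> measurable (restrict_space borel \<Omega>) (restrict_space borel (V m)) \<and>
               distr \<mu> (\<mu>s m) (T m) = \<mu>s m \<and>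
               (SUP y\<in>\<Omega>. norm (T m y - y)) \<le> K * \<epsilon> m"
    and "continuous (at 0 within {0..}) \<eta>" and "antimono_on {0..} \<eta>" and "\<eta> 0 > 0"
    and "D > 0" and "\<forall>y\<in>\<Omega>. 1 / D \<le> \<rho> y \<and> \<rho> y \<le> D"
    and "n \<ge> 1" and "s \<ge> 2 * K * \<epsilon> n" and "x \<in> V n" and "ball x s \<subseteq> \<Omega>"
  shows "1 + real (card (neighbours (geometric_graph (V n) s) x))
           \<ge> pi powr (real CARD('d) / 2) * s ^ CARD('d) /
              (max_mass (V n) (\<mu>s n) * D * 2 ^ CARD('d) * Gamma (real CARD('d) / 2 + 1))"
proof -
  have Vn: "finite (V n)" "V n \<subseteq> \<Omega>"
    using assms(8) \<open>n \<ge> 1\<close> by auto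
  have \<mu>n: "prob_space (\<mu>s n)" "space (\<mu>s n) = V n"
      "sets (\<mu>s n) = sets (restrict_space borel (V n))"
    using assms(9) \<open>n \<ge> 1\<close> by auto
  have T: "T n \<in> measurable (restrict_space borel \<Omega>) (restrict_space borel (V n))"
      "distr \<mu> (\<mu>s n) (T n) = \<mu>s n" "(SUP y\<in>\<Omega>. norm (T n y - y)) \<le> K * \<epsilon> n"
    using assms(14) \<open>n \<ge> 1\<close> by auto
  have s: "0 < s" "K * \<epsilon> n \<le> s / 2"
  proof -
    have "0 < K * \<epsilon> n"
      using assms(10) \<open>n \<ge> 1\<close> \<open>K > 0\<close> by simp
    then show "0 < s" "K * \<epsilon> n \<le> s / 2"
      using \<open>s \<ge> 2 * K * \<epsilon> n\<close> by linarith+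
  qed
  interpret Mn: prob_space "\<mu>s n" by (rule \<mu>n)
  interpret M: prob_space \<mu> by (rule assms(4))
  define A where "A = V n \<inter> cball x s"
  define B where "B = ball x (s / 2)"
  have A_sets: "A \<in> sets (\<mu>s n)"
    using Vn by (auto simp: A_def \<mu>n sets_restrict_space)
  have B_sub: "B \<subseteq> \<Omega>"
    using \<open>ball x s \<subseteq> \<Omega>\<close> s by (auto simp: B_def)
  have space_\<mu>: "space \<mu> = \<Omega>"
    by (simp add: assms(7) space_restrict_space)
  have sets_\<mu>: "sets \<mu> = sets (restrict_space borel \<Omega>)"
    by (simp add: assms(7) sets_restrict_space)
  have T_meas: "T n \<in> measurable \<mu> (\<mu>s n)"
    using T(1) measurable_cong_sets[OF sets_\<mu> \<mu>n(3)] by simp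
  have T_V: "T n y \<in> V n" if "y \<in> \<Omega>" for y
    using measurable_space[OF T_meas] that by (simp add: space_\<mu> \<mu>n(2))
  have "bounded (T n ` \<Omega>)"
    using T_V by (intro bounded_subset[OF finite_imp_bounded[OF Vn(1)]]) auto
  then have disp: "norm (T n y - y) \<le> s / 2" if "y \<in> \<Omega>" for y
    using displacement_le_of_SUP_le[OF \<open>bounded \<Omega>\<close> _ T(3) that] s by linarith
  have B_to_A: "B \<subseteq> T n -` A \<inter> space \<mu>"
  proof
    fix y assume y: "y \<in> B"
    then have "y \<in> \<Omega>" using B_sub by auto
    moreover have "dist x (T n y) \<le> dist x y + norm (T n y - y)"
      using dist_triangle[of x "T n y" y] by (simp add: dist_norm norm_minus_commute)
    ultimately show "y \<in> T n -` A \<inter> space \<mu>"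
      using y disp[of y] T_V[of y] by (auto simp: A_def B_def space_\<mu>)
  qed
  have vol: "measure lborel B = pi powr (real CARD('d) / 2) / Gamma (real CARD('d) / 2 + 1) * (s / 2) ^ CARD('d)"
    using s content_ball[of "s / 2" x] by (simp add: B_def unit_ball_vol_def)
  have "ennreal (1 / D) * emeasure lborel B \<le> emeasure \<mu> B"
    unfolding assms(7)
  proof (rule emeasure_density_restrict_space_ge)
    show "(\<lambda>y. ennreal (\<rho> y)) \<in> borel_measurable (restrict_space borel \<Omega>)"
      using borel_measurable_continuous_on_restrict[OF assms(5)] by measurable
    show "ennreal (1 / D) \<le> ennreal (\<rho> y)" if "y \<in> B" for y
      using that B_sub assms(19) by (intro ennreal_leI) auto
  qed (use \<open>open \<Omega>\<close> B_sub in \<open>auto simp: B_def\<close>)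
  moreover have "emeasure lborel B = ennreal (measure lborel B)"
    unfolding B_def by (intro emeasure_eq_ennreal_measure) (use emeasure_lborel_ball_finite[of x "s / 2"] in auto)
  ultimately have "1 / D * measure lborel B \<le> measure \<mu> B"
    using \<open>D > 0\<close> by (simp add: M.emeasure_eq_measure flip: ennreal_mult)
  also have "\<dots> \<le> measure \<mu> (T n -` A \<inter> space \<mu>)"
    using B_to_A measurable_sets[OF T_meas A_sets] by (rule M.finite_measure_mono)
  also have "\<dots> = measure (distr \<mu> (\<mu>s n) (T n)) A"
    using T_meas A_sets by (simp add: measure_distr)
  also have "\<dots> \<le> real (card A) * max_mass (V n) (\<mu>s n)"
    unfolding T(2) using Vn(1)
    by (intro measure_le_card_mult_max_mass Mn.finite_measure_axioms)
       (auto simp: A_def \<mu>n(3) sets_restrict_space)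
  finally have key: "measure lborel B / D \<le> real (card A) * max_mass (V n) (\<mu>s n)"
    by simp
  have "0 \<le> max_mass (V n) (\<mu>s n)"
  proof -
    have "measure (\<mu>s n) {x} \<le> max_mass (V n) (\<mu>s n)"
      unfolding max_mass_def using Vn(1) \<open>x \<in> V n\<close> by (intro Max_ge) auto
    then show ?thesis
      using measure_nonneg order_trans by blast
  qed
  \<comment> \<open>The case of a vanishing maximum is settled by the convention \<open>r / 0 = 0\<close>.\<close>
  then have "measure lborel B / D / max_mass (V n) (\<mu>s n) \<le> real (card A)"
    using mult_imp_div_pos_le[OF _ key] by (cases "max_mass (V n) (\<mu>s n) = 0") simp_all
  moreover have "measure lborel B / D / max_mass (V n) (\<mu>s n) =
      pi powr (real CARD('d) / 2) * s ^ CARD('d) /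
        (max_mass (V n) (\<mu>s n) * D * 2 ^ CARD('d) * Gamma (real CARD('d) / 2 + 1))"
    by (simp add: vol power_divide mult_ac)
  moreover have "1 + real (card (neighbours (geometric_graph (V n) s) x)) = real (card A)"
    using card_closed_neighbourhood_geometric_graph[OF Vn(1) \<open>x \<in> V n\<close>, of s] s
    unfolding A_def by linarith
  ultimately show ?thesis by linarith
qed

end
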